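(* Let $n=2$, let $\mathbf{A}_1,\mathbf{A}_2$ be $d\times d$ positive semidefinite matrices, and let $1\le k\le n$. Then both of the following inequalities hold: $$\left\| \mathbb{E}_{\mathrm{wo}}\left[ \prod_{j=1}^k \mathbf{A}_{i_j} \right]\right\|\leq \left\| \mathbb{E}_{\mathrm{wr}}\left[ \prod_{j=1}^k \mathbf{A}_{i_j} \right]\right\|$$ and $$\left\| \mathbb{E}_{\mathrm{wo}}\left[ \prod_{j=1}^k \mathbf{A}_{i_{k-j+1}}\prod_{j=1}^k \mathbf{A}_{i_j}\right] \right\| \leq \left\| \mathbb{E}_{\mathrm{wr}}\left[ \prod_{j=1}^k \mathbf{A}_{i_{k-j+1}}\prod_{j=1}^k \mathbf{A}_{i_j}\right] \right\| .$$
   Context: Matrices are real and positive semidefinite matrices are symmetric; $\|\cdot\|$ is the operator (spectral) norm. For a function $f$ of $k$ matrix arguments and a tuple $(\mathbf{A}_1,\dots,\mathbf{A}_n)$ with $k\le n$, the without-replacement expectation is $$\mathbb{E}_{\mathrm{wo}}[f(\mathbf{A}_{i_1},\ldots,\mathbf{A}_{i_k})]=\frac{(n-k)!}{n!}\sum_{j_1,\dots,j_k \text{ pairwise distinct in }\{1,\dots,n\}} f(\mathbf{A}_{j_1},\ldots,\mathbf{A}_{j_k}),$$ and the with-replacement expectation is $$\mathbb{E}_{\mathrm{wr}}[f(\mathbf{A}_{i_1},\ldots,\mathbf{A}_{i_k})]=n^{-k}\sum_{(j_1,\ldots,j_k)\in\{1,\dots,n\}^k} f(\mathbf{A}_{j_1},\ldots,\mathbf{A}_{j_k}).$$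 Product convention: $\prod_{j=1}^k \mathbf{M}_j$ means $\mathbf{M}_k\mathbf{M}_{k-1}\cdots\mathbf{M}_1$ (the matrix with smallest index is applied first, subsequent ones multiply on the left). Thus $\prod_{j=1}^k \mathbf{A}_{i_{k-j+1}}\prod_{j=1}^k \mathbf{A}_{i_j}=\mathbf{A}_{i_1}\cdots \mathbf{A}_{i_k}\mathbf{A}_{i_k}\cdots \mathbf{A}_{i_1}$. *)

theory Defs
  imports "HOL-Analysis.Analysis"
begin

definition positive_semidefinite :: "real^'d^'d \<Rightarrow> bool" where
  "positive_semidefinite A \<longleftrightarrow> transpose A = A \<and> (\<forall>x. 0 \<le> x \<bullet> (A *v x))"

text \<open>The norm on \<open>real^'d\<close> is the Euclidean one, so this is the spectral norm.  (The
  type-class \<open>norm\<close> on \<open>real^'d^'d\<close> would be the Frobenius norm.)\<close>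

definition spectral_norm :: "real^'d^'d \<Rightarrow> real" where
  "spectral_norm A = onorm (\<lambda>x. A *v x)"

text \<open>Ordered product with the factor of smallest index on the right:
  \<open>M k ** M (k - 1) ** \<dots> ** M 1\<close>.\<close>

primrec matrix_prod :: "nat \<Rightarrow> (nat \<Rightarrow> real^'d^'d) \<Rightarrow> real^'d^'d" where
  "matrix_prod 0 M = mat 1"
| "matrix_prod (Suc k) M = M (Suc k) ** matrix_prod k M"

text \<open>An index tuple \<open>(j\<^sub>1, \<dots>, j\<^sub>k)\<close> is an extensional function from \<open>{1..k}\<close> to \<open>{1..n}\<close>.
  A function \<open>f\<close> of \<open>k\<close> arguments is represented as a function of a sequence, which is meant
  to depend only on the entries with indices \<open>1, \<dots>, k\<close>.\<close>

definition expectation_wo ::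
  "nat \<Rightarrow> nat \<Rightarrow> (nat \<Rightarrow> 'a) \<Rightarrow> ((nat \<Rightarrow> 'a) \<Rightarrow> 'b::real_vector) \<Rightarrow> 'b" where
  "expectation_wo n k A f =
     (fact (n - k) / fact n) *\<^sub>R
       (\<Sum>j \<in> {j \<in> {1..k} \<rightarrow>\<^sub>E {1..n}. inj_on j {1..k}}. f (\<lambda>l. A (j l)))"

definition expectation_wr ::
  "nat \<Rightarrow> nat \<Rightarrow> (nat \<Rightarrow> 'a) \<Rightarrow> ((nat \<Rightarrow> 'a) \<Rightarrow> 'b::real_vector) \<Rightarrow> 'b" where
  "expectation_wr n k A f =
     (1 / real n ^ k) *\<^sub>R (\<Sum>j \<in> {1..k} \<rightarrow>\<^sub>E {1..n}. f (\<lambda>l. A (j l)))"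

end

theory Submission
  imports Defs
begin

text \<open>
  For \<open>k = 1\<close> both sides coincide.  For \<open>k = 2\<close>, write \<open>L = \<parallel>A + B\<parallel>\<close>.  Everything rests on the
  arithmetic-geometric mean inequality \<open>4 \<parallel>A B\<parallel> \<le> L\<^sup>2\<close> for positive semidefinite matrices
  (Bhatia and Kittaneh).  By the triangle inequality it bounds the without-replacement sides by
  \<open>L\<^sup>2 / 4\<close> and \<open>L\<^sup>4 / 16\<close>.  The first with-replacement side is exactly \<open>\<parallel>(A + B)\<^sup>2\<parallel> / 4 = L\<^sup>2 / 4\<close>.
  The second is at least \<open>L\<^sup>4 / 16\<close>, because \<open>(A + B)\<^sup>2 x\<close> is the sum of \<open>A A x\<close>, \<open>A B x\<close>,
  \<open>B A x\<close> and \<open>B B x\<close>, whose squared norms add up to the quadratic form of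
  \<open>A\<^sup>4 + A B\<^sup>2 A + B A\<^sup>2 B + B\<^sup>4\<close> at \<open>x\<close>.
\<close>

section \<open>The spectral norm\<close>

lemma norm_matrix_vector_mult_le:
  fixes A :: "real^'d^'d"
  shows "norm (A *v x) \<le> spectral_norm A * norm x"
  unfolding spectral_norm_def by (rule onorm) (rule matrix_vector_mul_bounded_linear)

lemma spectral_norm_nonneg: "0 \<le> spectral_norm (A :: real^'d^'d)"
  unfolding spectral_norm_def by (rule onorm_pos_le) (rule matrix_vector_mul_bounded_linear)

lemma spectral_norm_le:
  fixes A :: "real^'d^'d"
  assumes "\<And>x. norm (A *v x) \<le> c * norm x"
  shows "spectral_norm A \<le> c"
  unfolding spectral_norm_def using assms by (rule onorm_le)

lemma spectral_norm_add_le: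
  "spectral_norm (A + B) \<le> spectral_norm A + spectral_norm (B :: real^'d^'d)"
  unfolding spectral_norm_def matrix_vector_mult_add_rdistrib
  by (intro onorm_triangle matrix_vector_mul_bounded_linear)

lemma spectral_norm_scaleR:
  "spectral_norm (c *\<^sub>R A) = \<bar>c\<bar> * spectral_norm (A :: real^'d^'d)"
  unfolding spectral_norm_def scaleR_matrix_vector_assoc[symmetric]
  by (intro onorm_scaleR matrix_vector_mul_bounded_linear)

lemma spectral_norm_mult_le:
  "spectral_norm (A ** B) \<le> spectral_norm A * spectral_norm (B :: real^'d^'d)"
proof -
  have "onorm ((\<lambda>x. A *v x) \<circ> (\<lambda>x. B *v x)) \<le> onorm (\<lambda>x. A *v x) * onorm (\<lambda>x. B *v x)"
    by (intro onorm_compose matrix_vector_mul_bounded_linear)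
  then show ?thesis
    by (simp add: spectral_norm_def o_def matrix_vector_mul_assoc)
qed

lemma inner_matrix_vector_mult_le:
  fixes A :: "real^'d^'d"
  shows "x \<bullet> (A *v x) \<le> spectral_norm A * (norm x)\<^sup>2"
proof -
  have "x \<bullet> (A *v x) \<le> norm x * norm (A *v x)"
    by (rule norm_cauchy_schwarz)
  also have "\<dots> \<le> norm x * (spectral_norm A * norm x)"
    by (intro mult_left_mono norm_matrix_vector_mult_le norm_ge_zero)
  finally show ?thesis
    by (simp add: power2_eq_square algebra_simps)
qed

text \<open>Lets bounds by quadratic forms, where norms appear squared, pass to the spectral
  norm.\<close>

lemma spectral_norm_power2_le:
  fixes A :: "real^'d^'d"
  assumes "0 \<le> c" and "\<And>x. (norm (A *v x))\<^sup>2 \<le> c * (norm x)\<^sup>2"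
  shows "(spectral_norm A)\<^sup>2 \<le> c"
proof -
  have "norm (A *v x) \<le> sqrt c * norm x" for x
    using real_le_rsqrt[OF assms(2)[of x]] by (simp add: real_sqrt_mult)
  then have "spectral_norm A \<le> sqrt c"
    by (rule spectral_norm_le)
  then have "(spectral_norm A)\<^sup>2 \<le> (sqrt c)\<^sup>2"
    by (intro power_mono spectral_norm_nonneg)
  then show ?thesis
    using assms(1) by simp
qed

lemma inner_matrix_vector_symmetric:
  fixes A :: "real^'d^'d"
  assumes "transpose A = A"
  shows "x \<bullet> (A *v y) = (A *v x) \<bullet> y"
  using dot_lmul_matrix[of x A y] assms by (metis transpose_matrix_vector)

lemma transpose_matrix_add: "transpose (A + B) = transpose A + transpose (B :: 'a::plus^'n^'m)"
  by (simp add: transpose_def vec_eq_iff)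

text \<open>By symmetry the squared norm of \<open>A *v x\<close> is the quadratic form of
  \<open>A ** A\<close> at \<open>x\<close>. With submultiplicativity this is an equality.\<close>

lemma spectral_norm_symmetric_square:
  fixes A :: "real^'d^'d"
  assumes "transpose A = A"
  shows "(spectral_norm A)\<^sup>2 \<le> spectral_norm (A ** A)"
proof (rule spectral_norm_power2_le[OF spectral_norm_nonneg])
  fix x
  have "(norm (A *v x))\<^sup>2 = x \<bullet> ((A ** A) *v x)"
    by (simp add: power2_norm_eq_inner inner_matrix_vector_symmetric[OF assms]
        flip: matrix_vector_mul_assoc)
  then show "(norm (A *v x))\<^sup>2 \<le> spectral_norm (A ** A) * (norm x)\<^sup>2"
    using inner_matrix_vector_mult_le[of x "A ** A"] by simp
qed

section \<open>Products of positive semidefinite matrices\<close>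

text \<open>\<open>A\<close> induces a semi-inner product, possibly degenerate, so
  \<open>?c = 0\<close> is a separate case.\<close>

lemma positive_semidefinite_Cauchy_Schwarz:
  fixes A :: "real^'d^'d"
  assumes "positive_semidefinite A"
  shows "(x \<bullet> (A *v y))\<^sup>2 \<le> (x \<bullet> (A *v x)) * (y \<bullet> (A *v y))"
proof -
  let ?a = "x \<bullet> (A *v x)" and ?b = "x \<bullet> (A *v y)" and ?c = "y \<bullet> (A *v y)"
  have sym: "y \<bullet> (A *v x) = ?b"
    using assms inner_matrix_vector_symmetric[of A y x]
    by (simp add: positive_semidefinite_def inner_commute)
  have form: "0 \<le> s\<^sup>2 * ?a + 2 * s * t * ?b + t\<^sup>2 * ?c" for s t :: real
  proof -
    have "0 \<le> (s *\<^sub>R x + t *\<^sub>R y) \<bullet> (A *v (s *\<^sub>R x + t *\<^sub>R y))"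
      using assms by (auto simp: positive_semidefinite_def)
    also have "\<dots> = s\<^sup>2 * ?a + 2 * s * t * ?b + t\<^sup>2 * ?c"
      by (simp add: matrix_vector_right_distrib matrix_vector_mult_scaleR inner_add_left
          inner_add_right sym power2_eq_square algebra_simps)
    finally show ?thesis .
  qed
  have "0 \<le> ?c"
    using assms by (auto simp: positive_semidefinite_def)
  show ?thesis
  proof (cases "?c = 0")
    case True
    have "?b = 0"
    proof (rule ccontr)
      assume "?b \<noteq> 0"
      \<comment> \<open>With \<open>?c = 0\<close> the form is affine in \<open>t\<close>; this
        \<open>t\<close> gives it the value -1.\<close>
      then show False
        using form[of 1 "- (?a + 1) / (2 * ?b)"] True by (simp add: field_simps)
    qed
    then show ?thesis
      using True by simp
  next
    case False
    \<comment> \<open>The vector \<open>x - (?b / ?c) y\<close> minimises the form along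
      \<open>y\<close>; scaling by \<open>?c\<close> avoids the division.\<close>
    have "0 \<le> ?c\<^sup>2 * ?a + 2 * ?c * (- ?b) * ?b + (- ?b)\<^sup>2 * ?c"
      by (rule form)
    also have "\<dots> = ?c * (?a * ?c - ?b\<^sup>2)"
      by (simp add: power2_eq_square algebra_simps)
    finally show ?thesis
      using False \<open>0 \<le> ?c\<close> by (simp add: zero_le_mult_iff)
  qed
qed

text \<open>The vector \<open>p = A u\<close> witnesses that \<open>A\<close> dominates the rank one matrix
  \<open>p p\<^sup>T / \<parallel>p\<parallel>\<close>.\<close>

lemma positive_semidefinite_dominates_rank_one:
  fixes A :: "real^'d^'d"
  assumes "positive_semidefinite A" and "norm u = 1"
  shows "(x \<bullet> (A *v u))\<^sup>2 \<le> norm (A *v u) * (x \<bullet> (A *v x))"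
proof -
  have "u \<bullet> (A *v u) \<le> norm (A *v u)"
    using norm_cauchy_schwarz[of u "A *v u"] assms(2) by simp
  then have "(x \<bullet> (A *v x)) * (u \<bullet> (A *v u)) \<le> (x \<bullet> (A *v x)) * norm (A *v u)"
    using assms(1) by (intro mult_left_mono) (auto simp: positive_semidefinite_def)
  then show ?thesis
    using positive_semidefinite_Cauchy_Schwarz[OF assms(1), of x u] by (simp add: mult.commute)
qed

text \<open>After reduction to rank one matrices, the sum is tested on the bisector \<open>e + f\<close> of the two
  image directions.\<close>

lemma inner_image_le:
  fixes A B :: "real^'d^'d"
  assumes A: "positive_semidefinite A" and B: "positive_semidefinite B"
    and u: "norm u = 1" and v: "norm v = 1"
  shows "4 * ((A *v u) \<bullet> (B *v v)) \<le> (spectral_norm (A + B))\<^sup>2"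
proof (cases "(A *v u) \<bullet> (B *v v) \<le> 0")
  case True
  then show ?thesis
    by (smt (verit) zero_le_power2)
next
  case False
  define p q where "p = A *v u" and "q = B *v v"
  define s t where "s = norm p" and "t = norm q"
  define e f where "e = p /\<^sub>R s" and "f = q /\<^sub>R t"
  define c where "c = e \<bullet> f"
  define L where "L = spectral_norm (A + B)"
  have "0 < p \<bullet> q"
    using False by (simp add: p_def q_def)
  then have st: "0 < s" "0 < t"
    by (auto simp: s_def t_def)
  have ee: "e \<bullet> e = 1" and ff: "f \<bullet> f = 1"
    using st by (simp_all add: e_def f_def s_def t_def dot_square_norm power2_eq_square)
  have p: "p = s *\<^sub>R e" and q: "q = t *\<^sub>R f"
    using st by (simp_all add: e_def f_def)
  have pq: "p \<bullet> q = s * t * c"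
    by (simp add: p q c_def)
  have c: "0 < c"
    using \<open>0 < p \<bullet> q\<close> st unfolding pq by (metis mult_pos_pos zero_less_mult_pos)
  let ?x = "e + f"
  \<comment> \<open>As \<open>e\<close> is a unit vector,
    \<open>?x \<bullet> p = s * (1 + c)\<close>; one factor \<open>s\<close> then cancels.\<close>
  have "(s * (1 + c))\<^sup>2 \<le> s * (?x \<bullet> (A *v ?x))"
    using positive_semidefinite_dominates_rank_one[OF A u, of ?x]
    by (simp add: p_def[symmetric] s_def[symmetric])
      (simp add: p inner_add_left ee c_def inner_commute[of f e])
  then have xA: "s * (1 + c)\<^sup>2 \<le> ?x \<bullet> (A *v ?x)"
    using st by (simp add: power_mult_distrib power2_eq_square mult_ac)
  have "(t * (1 + c))\<^sup>2 \<le> t * (?x \<bullet> (B *v ?x))"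
    using positive_semidefinite_dominates_rank_one[OF B v, of ?x]
    by (simp add: q_def[symmetric] t_def[symmetric])
      (simp add: q inner_add_left ff c_def add.commute)
  then have xB: "t * (1 + c)\<^sup>2 \<le> ?x \<bullet> (B *v ?x)"
    using st by (simp add: power_mult_distrib power2_eq_square mult_ac)
  have xx: "(norm ?x)\<^sup>2 = 2 * (1 + c)"
    by (simp add: power2_norm_eq_inner inner_add_left inner_add_right ee ff c_def
        inner_commute[of f e])
  have "(s + t) * (1 + c)\<^sup>2 \<le> ?x \<bullet> ((A + B) *v ?x)"
    using xA xB by (simp add: matrix_vector_mult_add_rdistrib inner_add_right distrib_right)
  also have "\<dots> \<le> L * (2 * (1 + c))"
    using inner_matrix_vector_mult_le[of ?x "A + B"] by (simp add: L_def xx)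
  finally have "((s + t) * (1 + c)) * (1 + c) \<le> (2 * L) * (1 + c)"
    by (simp add: power2_eq_square algebra_simps)
  then have "(s + t) * (1 + c) \<le> 2 * L"
    using c by (simp add: mult_le_cancel_right)
  then have "((s + t) * (1 + c))\<^sup>2 \<le> (2 * L)\<^sup>2"
    using st c by (intro power_mono) auto
  \<comment> \<open>Two scalar arithmetic-geometric mean inequalities, for \<open>s, t\<close> and
    for \<open>1, c\<close>, are multiplied; positivity of \<open>c\<close> permits this.\<close>
  moreover have "(4 * (s * t)) * (4 * c) \<le> (s + t)\<^sup>2 * (1 + c)\<^sup>2"
  proof (rule mult_mono)
    show "4 * (s * t) \<le> (s + t)\<^sup>2"
      using zero_le_power2[of "s - t"] by (simp add: power2_eq_square algebra_simps)
    show "4 * c \<le> (1 + c)\<^sup>2"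
      using zero_le_power2[of "1 - c"] by (simp add: power2_eq_square algebra_simps)
  qed (use c in auto)
  ultimately have "4 * (p \<bullet> q) \<le> L\<^sup>2"
    by (simp add: pq power_mult_distrib)
  then show ?thesis
    by (simp add: p_def q_def L_def)
qed

text \<open>The bound for images of unit vectors extends to all vectors by homogeneity. For
  \<open>A = B\<close> both sides agree, so 1/4 is the best constant.\<close>

theorem spectral_norm_mult_positive_semidefinite_le:
  fixes A B :: "real^'d^'d"
  assumes A: "positive_semidefinite A" and B: "positive_semidefinite B"
  shows "spectral_norm (A ** B) \<le> (spectral_norm (A + B))\<^sup>2 / 4"
proof (rule spectral_norm_le)
  fix x
  let ?y = "(A ** B) *v x"
  have *: "(A *v u) \<bullet> (B *v v) \<le> (spectral_norm (A + B))\<^sup>2 / 4 * (norm u * norm v)" for u v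
  proof (cases "u = 0 \<or> v = 0")
    case True
    then show ?thesis by auto
  next
    case False
    then have "4 * ((A *v (u /\<^sub>R norm u)) \<bullet> (B *v (v /\<^sub>R norm v))) \<le> (spectral_norm (A + B))\<^sup>2"
      by (intro inner_image_le A B) auto
    then show ?thesis
      using False by (simp add: matrix_vector_mult_scaleR field_simps)
  qed
  \<comment> \<open>\<open>?y\<close> is its own test vector: moving \<open>A\<close> across gives
    an inner product of images, and one factor \<open>norm ?y\<close> cancels.\<close>
  have "norm ?y * norm ?y = ?y \<bullet> (A *v (B *v x))"
    by (simp add: matrix_vector_mul_assoc power2_norm_eq_inner flip: power2_eq_square)
  also have "\<dots> = (A *v ?y) \<bullet> (B *v x)"
    using A by (intro inner_matrix_vector_symmetric) (simp add: positive_semidefinite_def)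
  also have "\<dots> \<le> ((spectral_norm (A + B))\<^sup>2 / 4 * norm x) * norm ?y"
    using *[of ?y x] by (simp add: mult_ac)
  finally show "norm ?y \<le> (spectral_norm (A + B))\<^sup>2 / 4 * norm x"
    by (cases "?y = 0") (simp_all add: mult_le_cancel_right)
qed

section \<open>Lower bound for the second with-replacement side\<close>

lemma norm_sum4_power2_le:
  fixes a b c d :: "'a::real_inner"
  shows "(norm (a + b + c + d))\<^sup>2 \<le> 4 * ((norm a)\<^sup>2 + (norm b)\<^sup>2 + (norm c)\<^sup>2 + (norm d)\<^sup>2)"
proof -
  \<comment> \<open>The parallelogram law without its nonnegative term
    \<open>(norm (x - y))\<^sup>2\<close>.\<close>
  have 2: "(norm (x + y))\<^sup>2 \<le> 2 * ((norm x)\<^sup>2 + (norm y)\<^sup>2)" for x y :: 'a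
    using zero_le_power2[of "norm (x - y)"]
    by (simp add: power2_norm_eq_inner inner_add_left inner_add_right inner_diff_left
        inner_diff_right inner_commute[of y x])
  show ?thesis
    using 2[of "a + b" "c + d"] 2[of a b] 2[of c d] by (simp add: add.assoc)
qed

lemma spectral_norm_sum_power4_le:
  fixes A B :: "real^'d^'d"
  assumes A: "transpose A = A" and B: "transpose B = B"
  shows "(spectral_norm (A + B)) ^ 4 \<le>
    4 * spectral_norm (A ** A ** (A ** A) + A ** B ** (B ** A) +
      (B ** A ** (A ** B) + B ** B ** (B ** B)))" (is "_ \<le> 4 * spectral_norm ?Z")
proof -
  have AB: "transpose (A + B) = A + B"
    by (simp add: transpose_matrix_add A B)
  have "(spectral_norm ((A + B) ** (A + B)))\<^sup>2 \<le> 4 * spectral_norm ?Z"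
  proof (rule spectral_norm_power2_le)
    show "0 \<le> 4 * spectral_norm ?Z"
      by (simp add: spectral_norm_nonneg)
    fix x
    have "(norm (((A + B) ** (A + B)) *v x))\<^sup>2 =
        (norm (A *v (A *v x) + A *v (B *v x) + B *v (A *v x) + B *v (B *v x)))\<^sup>2"
      by (simp add: matrix_vector_right_distrib matrix_vector_mult_add_rdistrib add_ac
          flip: matrix_vector_mul_assoc)
    also have "\<dots> \<le> 4 * ((norm (A *v (A *v x)))\<^sup>2 + (norm (A *v (B *v x)))\<^sup>2 +
        (norm (B *v (A *v x)))\<^sup>2 + (norm (B *v (B *v x)))\<^sup>2)"
      by (rule norm_sum4_power2_le)
    \<comment> \<open>Each word in \<open>?Z\<close> is a palindrome, hence of the form
      \<open>transpose M ** M\<close> with \<open>M\<close> a product of two factors.\<close>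
    also have "\<dots> = 4 * (x \<bullet> (?Z *v x))"
      by (simp add: power2_norm_eq_inner matrix_vector_mult_add_rdistrib inner_add_right
          inner_matrix_vector_symmetric[OF A] inner_matrix_vector_symmetric[OF B]
          flip: matrix_vector_mul_assoc)
    also have "\<dots> \<le> 4 * (spectral_norm ?Z * (norm x)\<^sup>2)"
      by (intro mult_left_mono inner_matrix_vector_mult_le) simp
    finally show "(norm (((A + B) ** (A + B)) *v x))\<^sup>2 \<le> 4 * spectral_norm ?Z * (norm x)\<^sup>2"
      by simp
  qed
  moreover have "((spectral_norm (A + B))\<^sup>2)\<^sup>2 \<le> (spectral_norm ((A + B) ** (A + B)))\<^sup>2"
    by (intro power_mono spectral_norm_symmetric_square[OF AB] zero_le_power2)
  ultimately show ?thesis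
    by simp
qed

section \<open>Expectations over index pairs\<close>

text \<open>The value \<open>undefined\<close> off 1 and 2 makes these functions extensional, as
  members of \<open>PiE\<close> must be.\<close>

definition index_pair :: "nat \<Rightarrow> nat \<Rightarrow> nat \<Rightarrow> nat" where
  "index_pair a b = (\<lambda>l. if l = 1 then a else if l = 2 then b else undefined)"

lemma index_pair_simps [simp]:
  "index_pair a b (Suc 0) = a" "index_pair a b 2 = b"
  by (simp_all add: index_pair_def)

text \<open>Keeps the listed tuples distinct when sums over them are expanded.\<close>

lemma index_pair_eq_iff: "index_pair a b = index_pair c d \<longleftrightarrow> a = c \<and> b = d"
  by (auto dest: fun_cong[of _ _ 1] fun_cong[of _ _ 2] simp: index_pair_def)

lemma PiE_pairs:
  "{1..2} \<rightarrow>\<^sub>E {1..2} =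
    {index_pair 1 1, index_pair 1 2, index_pair 2 1, index_pair 2 2}" (is "?P = ?R")
proof -
  have 12: "{1..2} = {1, 2::nat}"
    by auto
  have "j \<in> ?R" if "j \<in> ?P" for j
  proof -
    have "j 1 \<in> {1, 2}" "j 2 \<in> {1, 2}"
      using that unfolding 12 by auto
    then have mem: "index_pair (j 1) (j 2) \<in> ?R"
      by auto
    have eq: "index_pair (j 1) (j 2) = j"
    proof
      fix l
      show "index_pair (j 1) (j 2) l = j l"
        using that PiE_arb[of j "{1..2}" "\<lambda>_. {1..2}" l] by (auto simp: index_pair_def 12)
    qed
    show ?thesis
      using mem unfolding eq .
  qed
  moreover have "index_pair a b \<in> ?P" if "a \<in> {1, 2}" "b \<in> {1, 2}" for a b
    using that by (intro PiE_I) (auto simp: index_pair_def 12)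
  then have "?R \<subseteq> ?P"
    by simp
  ultimately show ?thesis
    by blast
qed

lemma expectation_wr_pairs:
  "expectation_wr 2 2 A f = (1 / 4) *\<^sub>R
    (f (\<lambda>l. A (index_pair 1 1 l)) + f (\<lambda>l. A (index_pair 1 2 l)) +
     (f (\<lambda>l. A (index_pair 2 1 l)) + f (\<lambda>l. A (index_pair 2 2 l))))"
  unfolding expectation_wr_def PiE_pairs by (simp add: index_pair_eq_iff add.assoc)

lemma expectation_wo_pairs:
  "expectation_wo 2 2 A f = (1 / 2) *\<^sub>R
    (f (\<lambda>l. A (index_pair 1 2 l)) + f (\<lambda>l. A (index_pair 2 1 l)))"
proof -
  have "{1..2} = {1, 2::nat}"
    by auto
  then have "{j \<in> {1..2} \<rightarrow>\<^sub>E {1..2}. inj_on j {1..2}} = {index_pair 1 2, index_pair 2 1}"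
    unfolding PiE_pairs by auto
  then show ?thesis
    by (simp add: expectation_wo_def index_pair_eq_iff)
qed

text \<open>Every map on a singleton is injective, so the index sets agree, and
  \<open>fact (n - 1) / fact n = 1 / n\<close>.\<close>

lemma expectation_wo_eq_wr_1:
  assumes "1 \<le> n"
  shows "expectation_wo n 1 A f = expectation_wr n 1 A f"
proof -
  have "fact n = real n * fact (n - 1)"
    using assms by (simp add: fact_reduce)
  then show ?thesis
    by (simp add: expectation_wo_def expectation_wr_def)
qed

theorem proposition3p2:
  fixes A :: "nat \<Rightarrow> real^'d^'d" and n k :: nat
  assumes "n = 2"
    and "\<And>i. i \<in> {1..n} \<Longrightarrow> positive_semidefinite (A i)"
    and "1 \<le> k" and "k \<le> n"
  shows "spectral_norm (expectation_wo n k A (\<lambda>B. matrix_prod k B))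
           \<le> spectral_norm (expectation_wr n k A (\<lambda>B. matrix_prod k B)) \<and>
         spectral_norm (expectation_wo n k A
             (\<lambda>B. matrix_prod k (\<lambda>j. B (k - j + 1)) ** matrix_prod k (\<lambda>j. B j)))
           \<le> spectral_norm (expectation_wr n k A
             (\<lambda>B. matrix_prod k (\<lambda>j. B (k - j + 1)) ** matrix_prod k (\<lambda>j. B j)))"
proof (cases "k = 1")
  case True
  have "1 \<le> n"
    using assms(1) by simp
  show ?thesis
    unfolding True expectation_wo_eq_wr_1[OF \<open>1 \<le> n\<close>] by (intro conjI order_refl)
next
  case False
  then have k: "k = 2"
    using assms by simp
  define C D where "C = A (Suc 0)" and "D = A 2"
  define L where "L = spectral_norm (C + D)"
  have psd: "positive_semidefinite C" "positive_semidefinite D"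
    using assms(1,2) by (simp_all add: C_def D_def)
  then have sym: "transpose C = C" "transpose D = D"
    by (simp_all add: positive_semidefinite_def)
  have prod2: "matrix_prod 2 M = M 2 ** M 1" for M :: "nat \<Rightarrow> real^'d^'d"
    by (simp add: numeral_2_eq_2)
  have CD: "spectral_norm (C ** D) \<le> L\<^sup>2 / 4" and DC: "spectral_norm (D ** C) \<le> L\<^sup>2 / 4"
    using spectral_norm_mult_positive_semidefinite_le[of C D]
      spectral_norm_mult_positive_semidefinite_le[of D C] psd
    by (simp_all add: L_def add.commute)
  have "spectral_norm (expectation_wo 2 2 A (matrix_prod 2)) \<le> L\<^sup>2 / 4"
    using CD DC spectral_norm_add_le[of "D ** C" "C ** D"]
    by (simp add: expectation_wo_pairs prod2 spectral_norm_scaleR flip: C_def D_def)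
  also have "L\<^sup>2 / 4 \<le> spectral_norm (expectation_wr 2 2 A (matrix_prod 2))"
  proof -
    have "transpose (C + D) = C + D"
      by (simp add: transpose_matrix_add sym)
    then have "L\<^sup>2 \<le> spectral_norm ((C + D) ** (C + D))"
      unfolding L_def by (rule spectral_norm_symmetric_square)
    \<comment> \<open>Order and grouping follow \<open>expectation_wr_pairs\<close>; the pair (1, 2)
      yields \<open>D ** C\<close>.\<close>
    also have "(C + D) ** (C + D) = C ** C + D ** C + (C ** D + D ** D)"
      by (simp add: matrix_eq matrix_vector_right_distrib matrix_vector_mult_add_rdistrib add_ac
          flip: matrix_vector_mul_assoc)
    finally show ?thesis
      by (simp add: expectation_wr_pairs prod2 spectral_norm_scaleR flip: C_def D_def)
  qed
  finally have first: "spectral_norm (expectation_wo 2 2 A (matrix_prod 2))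
    \<le> spectral_norm (expectation_wr 2 2 A (matrix_prod 2))" .
  let ?f = "\<lambda>B. matrix_prod 2 (\<lambda>j. B (2 - j + 1)) ** matrix_prod 2 (\<lambda>j. B j) :: real^'d^'d"
  \<comment> \<open>The index \<open>2 - j + 1\<close> swaps 1 and 2, so the left product is
    \<open>B 1 ** B 2\<close>.\<close>
  have f: "?f B = B 1 ** B 2 ** (B 2 ** B 1)" for B
    by (simp add: prod2 numeral_2_eq_2)
  have "spectral_norm (C ** D ** (D ** C)) \<le> L\<^sup>2 / 4 * (L\<^sup>2 / 4)"
    by (intro order_trans[OF spectral_norm_mult_le] mult_mono CD DC spectral_norm_nonneg) simp
  moreover have "spectral_norm (D ** C ** (C ** D)) \<le> L\<^sup>2 / 4 * (L\<^sup>2 / 4)"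
    by (intro order_trans[OF spectral_norm_mult_le] mult_mono CD DC spectral_norm_nonneg) simp
  ultimately have "spectral_norm (expectation_wo 2 2 A ?f) \<le> L\<^sup>2 / 4 * (L\<^sup>2 / 4)"
    using spectral_norm_add_le[of "C ** D ** (D ** C)" "D ** C ** (C ** D)"]
    unfolding f expectation_wo_pairs
    by (simp add: spectral_norm_scaleR flip: C_def D_def)
  also have "\<dots> = L ^ 4 / 16"
    by (simp add: power4_eq_xxxx power2_eq_square)
  also have "\<dots> \<le> spectral_norm (expectation_wr 2 2 A ?f)"
    using spectral_norm_sum_power4_le[OF sym] unfolding f expectation_wr_pairs
    by (simp add: spectral_norm_scaleR L_def flip: C_def D_def)
  finally show ?thesis
    using first by (simp add: k assms(1))
qed

end
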